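(* Let $\mathcal{A}_r$ be the free associative algebra of (finite) rank $r>1$ over a field $\Phi$. Then $\mathcal{A}_r$ has a simple right module whose growth is maximal.
   Context: $\mathcal{A}_r=\Phi\langle x_1,\ldots,x_r\rangle$ with $1$; modules are right and unital. $R(n)$ is the span of all monomials of degree at most $n$ in $\mathcal{A}_r$. For a module $V$ generated by a finite set $A$, the growth function is $g_{A,V}(n)=\dim_\Phi(A R(n))$. Functions $f,g$ are equivalent if for some nonnegative integers $C,C'$ one has $f(n)\le g(n+C)$ and $g(n)\le f(n+C')$ for all $n\ge0$. The growth of a finitely generated module is maximal if its growth function is equivalent to that of the free module of rank 1, i.e. to $r^n$ (this does not depend on the finite generating set). *)

theory Defs
  imports Complex_Main "HOL-Library.Poly_Mapping" "HOL-Library.Cardinality"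
begin

section \<open>The free associative algebra\<close>

datatype 'x free_monoid = Word (letters: "'x list")

instantiation free_monoid :: (type) monoid_add
begin

definition zero_free_monoid :: "'a free_monoid"
  where "0 = Word []"

definition plus_free_monoid :: "'a free_monoid \<Rightarrow> 'a free_monoid \<Rightarrow> 'a free_monoid"
  where "u + v = Word (letters u @ letters v)"

instance
  by standard (simp_all add: zero_free_monoid_def plus_free_monoid_def)

end

text \<open>
  Finitely supported functions on a monoid are multiplied by convolution, where
  \<^theory>\<open>HOL-Library.Poly_Mapping\<close> writes the (here noncommutative) monoid operation additively.
  So this is the free associative algebra with \<open>1\<close> over \<open>'k\<close>, freely generated by the letters
  \<open>'x\<close>; its rank is \<open>CARD('x)\<close>. The unit is \<open>Poly_Mapping.single 0 1\<close>.
\<close>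

type_synonym ('x, 'k) free_algebra = "'x free_monoid \<Rightarrow>\<^sub>0 'k"

definition monomial :: "'x free_monoid \<Rightarrow> ('x, 'k::field) free_algebra"
  where "monomial w = Poly_Mapping.single w 1"

definition monomial_deg :: "'x free_monoid \<Rightarrow> nat"
  where "monomial_deg w = length (letters w)"

definition scalar :: "'k::field \<Rightarrow> ('x, 'k) free_algebra"
  where "scalar c = Poly_Mapping.single 0 c"


section \<open>Right modules\<close>

text \<open>
  A module is given by its action on a type. Simple modules over the free algebra on finitely many
  letters are cyclic, hence have countable dimension over \<open>'k\<close>; so the infinite-dimensional
  ones all occur, up to isomorphism, as actions on the type \<open>nat \<Rightarrow>\<^sub>0 'k\<close>.
\<close>

locale right_module =
  fixes act :: "'v::ab_group_add \<Rightarrow> 'a::ring_1 \<Rightarrow> 'v"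
  assumes act_add_left: "act (u + v) a = act u a + act v a"
    and act_add_right: "act v (a + b) = act v a + act v b"
    and act_mult: "act v (a * b) = act (act v a) b"
    and act_one: "act v 1 = v"

definition submodule :: "('v::ab_group_add \<Rightarrow> 'a::ring_1 \<Rightarrow> 'v) \<Rightarrow> 'v set \<Rightarrow> bool"
  where "submodule act U \<longleftrightarrow>
    0 \<in> U \<and> (\<forall>u\<in>U. \<forall>v\<in>U. u + v \<in> U) \<and> (\<forall>u\<in>U. \<forall>a. act u a \<in> U)"

definition simple_right_module :: "('v::ab_group_add \<Rightarrow> 'a::ring_1 \<Rightarrow> 'v) \<Rightarrow> bool"
  where "simple_right_module act \<longleftrightarrow>
    right_module act \<and> (UNIV :: 'v set) \<noteq> {0} \<and>
    (\<forall>U. submodule act U \<longrightarrow> U = {0} \<or> U = UNIV)"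

definition generates :: "('v::ab_group_add \<Rightarrow> 'a::ring_1 \<Rightarrow> 'v) \<Rightarrow> 'v set \<Rightarrow> bool"
  where "generates act A \<longleftrightarrow> submodule act hull A = UNIV"


section \<open>Growth\<close>

text \<open>
  A right module over the free algebra is a vector space over \<open>'k\<close> via the action of
  the scalars. The multiplication \<open>(*)\<close> is the action of the free algebra on itself, that is,
  on the free module of rank 1.
\<close>

definition rscale ::
    "('v::ab_group_add \<Rightarrow> ('x, 'k::field) free_algebra \<Rightarrow> 'v) \<Rightarrow> 'k \<Rightarrow> 'v \<Rightarrow> 'v"
  where "rscale act c v = act v (scalar c)"

lemma scalar_add: "scalar (c + d) = scalar c + scalar d"
  by (simp add: scalar_def single_add)

lemma scalar_mult: "scalar (c * d) = scalar c * scalar d"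
  by (simp add: scalar_def mult_single)

lemma scalar_one: "scalar 1 = 1"
  by (simp add: scalar_def)

lemma vector_space_rscale:
  fixes act :: "'v::ab_group_add \<Rightarrow> ('x, 'k::field) free_algebra \<Rightarrow> 'v"
  assumes "right_module act"
  shows "vector_space (rscale act)"
proof -
  interpret right_module act by fact
  show ?thesis
    by standard (simp_all add: rscale_def scalar_add scalar_one act_add_left act_add_right act_one
        flip: act_mult scalar_mult, simp add: mult.commute)
qed

lemma right_module_regular: "right_module ((*) :: 'a::ring_1 \<Rightarrow> 'a \<Rightarrow> 'a)"
  by standard (simp_all add: algebra_simps)

lemma generates_regular: "generates ((*) :: 'a::ring_1 \<Rightarrow> 'a \<Rightarrow> 'a) {1}"
  unfolding generates_def hull_def submodule_def by (auto; metis mult_1)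

definition deg_le :: "nat \<Rightarrow> ('x, 'k::field) free_algebra set"
  where "deg_le n = module.span (rscale (*)) {monomial w | w. monomial_deg w \<le> n}"

text \<open>For \<open>R(n) = deg_le n\<close>: the subspace \<open>A R(n)\<close> and its dimension over \<open>'k\<close>.\<close>

definition growth_space ::
    "('v::ab_group_add \<Rightarrow> ('x, 'k::field) free_algebra \<Rightarrow> 'v) \<Rightarrow> 'v set \<Rightarrow> nat \<Rightarrow> 'v set"
  where "growth_space act A n = module.span (rscale act) {act a p | a p. a \<in> A \<and> p \<in> deg_le n}"

definition growth ::
    "('v::ab_group_add \<Rightarrow> ('x, 'k::field) free_algebra \<Rightarrow> 'v) \<Rightarrow> 'v set \<Rightarrow> nat \<Rightarrow> nat"
  where "growth act A n = vector_space.dim (rscale act) (growth_space act A n)"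

definition growth_equiv :: "(nat \<Rightarrow> nat) \<Rightarrow> (nat \<Rightarrow> nat) \<Rightarrow> bool"
  where "growth_equiv f g \<longleftrightarrow> (\<exists>C C'. \<forall>n. f n \<le> g (n + C) \<and> g n \<le> f (n + C'))"

text \<open>
  The equivalence class of \<open>growth act A\<close> does not depend on the finite generating set \<open>A\<close>;
  the definition asks for maximality with respect to all of them, and that there is one.
\<close>

definition maximal_growth ::
    "('v::ab_group_add \<Rightarrow> ('x, 'k::field) free_algebra \<Rightarrow> 'v) \<Rightarrow> bool"
  where "maximal_growth act \<longleftrightarrow>
    (\<exists>A. finite A \<and> generates act A) \<and>
    (\<forall>A. finite A \<and> generates act A \<longrightarrow>
      growth_equiv (growth act A) (growth ((*) :: ('x, 'k) free_algebra \<Rightarrow> _) {1}))"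


text \<open>The growth of the free module of rank 1 is that of \<open>r\<^sup>n\<close>, where \<open>r\<close> is the rank of the algebra.\<close>

lemma growth_regular:
  "growth ((*) :: ('x::finite, 'k::field) free_algebra \<Rightarrow> _) {1} n = (\<Sum>i\<le>n. CARD('x) ^ i)"
proof -
  let ?s = "rscale ((*) :: ('x, 'k) free_algebra \<Rightarrow> _)"
  interpret V: vector_space ?s
    by (rule vector_space_rscale[OF right_module_regular])
  define W where "W = {w :: 'x free_monoid. monomial_deg w \<le> n}"
  have s: "Poly_Mapping.lookup (?s c (monomial w)) w' = (if w = w' then c else 0)" for c w w'
    by (simp add: rscale_def scalar_def monomial_def mult_single lookup_single when_def)
  have inj: "inj (monomial :: _ \<Rightarrow> ('x, 'k) free_algebra)"
    unfolding inj_def monomial_def by (metis keys_single singleton_inject zero_neq_one)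
  have W: "W = Word ` {xs. set xs \<subseteq> UNIV \<and> length xs \<le> n}"
    unfolding W_def monomial_deg_def by (auto simp: image_iff) (metis free_monoid.collapse)
  have finW: "finite W"
    unfolding W by (intro finite_imageI finite_lists_length_le) simp
  have cardW: "card W = (\<Sum>i\<le>n. CARD('x) ^ i)"
    unfolding W by (subst card_image) (use card_lists_length_le[of "UNIV :: 'x set" n] in \<open>auto simp: inj_on_def\<close>)
  have ind: "V.independent (monomial ` W)"
  proof (rule V.independent_if_scalars_zero)
    show "finite (monomial ` W :: ('x, 'k) free_algebra set)" using finW by simp
    fix f :: "('x, 'k) free_algebra \<Rightarrow> 'k" and x :: "('x, 'k) free_algebra"
    assume sum0: "(\<Sum>x\<in>monomial ` W. ?s (f x) x) = 0" and "x \<in> monomial ` W"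
    then obtain w where w: "w \<in> W" "x = monomial w" by auto
    have "(\<Sum>v\<in>W. ?s (f (monomial v)) (monomial v)) = 0"
      using sum0 by (subst (asm) sum.reindex) (auto intro: inj_on_subset[OF inj])
    then have "Poly_Mapping.lookup (\<Sum>v\<in>W. ?s (f (monomial v)) (monomial v)) w = 0"
      by simp
    then show "f x = 0"
      using w finW by (simp add: lookup_sum s sum.delta)
  qed
  have "{monomial w |w. monomial_deg w \<le> n} = (monomial ` W :: ('x, 'k) free_algebra set)"
    by (auto simp: W_def)
  then have "growth ((*) :: ('x, 'k) free_algebra \<Rightarrow> _) {1} n = V.dim (V.span (V.span (monomial ` W)))"
    by (simp add: growth_def growth_space_def deg_le_def)
  also have "\<dots> = card (monomial ` W :: ('x, 'k) free_algebra set)"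
    by (simp only: V.span_span V.dim_span_eq_card_independent[OF ind])
  also have "\<dots> = card W"
    by (rule card_image) (rule inj_on_subset[OF inj], simp)
  finally show ?thesis using cardW by simp
qed

lemma growth_regular_equiv:
  assumes "CARD('x::finite) > 1"
  shows "growth_equiv (growth ((*) :: ('x, 'k::field) free_algebra \<Rightarrow> _) {1}) (\<lambda>n. CARD('x) ^ n)"
proof -
  let ?r = "CARD('x)"
  have le: "(\<Sum>i\<le>n. ?r ^ i) \<le> ?r ^ (n + 1)" for n
  proof (induction n)
    case (Suc n)
    have "(\<Sum>i\<le>Suc n. ?r ^ i) \<le> 2 * ?r ^ Suc n" using Suc by simp
    also have "\<dots> \<le> ?r * ?r ^ Suc n" using assms by (intro mult_right_mono) auto
    finally show ?case by simp
  qed (use assms in simp)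
  have ge: "?r ^ n \<le> (\<Sum>i\<le>n + 0. ?r ^ i)" for n
    by (rule member_le_sum) auto
  show ?thesis
    unfolding growth_equiv_def growth_regular using le ge by blast
qed

end

theory Submission
  imports Defs "HOL-Library.Sublist" "HOL-Library.Countable_Set"
begin

text \<open>
  Fix letters \<open>a \<noteq> b\<close> and assign to every word \<open>w\<^sub>0\<close> a number \<open>pad w\<^sub>0\<close>, where these numbers
  increase very fast along an enumeration of the words. Let \<open>V\<close> have as basis the
  words that have no prefix \<open>w a\<^bsup>pad w\<^sub>0\<^esup> b\<close> with \<open>|w| \<le> |w\<^sub>0|\<close>. A letter acts by
  appending it; if this leaves the basis, the result is by definition the empty word when the word
  reached is some \<open>w\<^sub>0 a\<^bsup>pad w\<^sub>0\<^esup> b\<close>, and zero otherwise. If \<open>w\<^sub>0\<close> is a longest word in the support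
  of \<open>v\<close>, then \<open>a\<^bsup>pad w\<^sub>0\<^esup> b\<close> annihilates all other words of the support and takes \<open>v\<close> to a
  nonzero multiple of the empty word, which generates \<open>V\<close>; so \<open>V\<close> is simple. Because the
  padding is long, at most half of the words of each length are lost, so the growth is maximal.
\<close>

section \<open>Modules from partial actions of the free monoid\<close>

definition smul :: "'k::field \<Rightarrow> ('i \<Rightarrow>\<^sub>0 'k) \<Rightarrow> ('i \<Rightarrow>\<^sub>0 'k)"
  where "smul c v = Poly_Mapping.map ((*) c) v"

lemma lookup_smul [simp]: "Poly_Mapping.lookup (smul c v) i = c * Poly_Mapping.lookup v i"
  by (simp add: smul_def map.rep_eq when_def)

lemma smul_add_right: "smul c (u + v) = smul c u + smul c v"
  by (rule poly_mapping_eqI) (simp add: lookup_add algebra_simps)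

lemma smul_add_left: "smul (c + d) v = smul c v + smul d v"
  by (rule poly_mapping_eqI) (simp add: lookup_add algebra_simps)

lemma smul_zero_left [simp]: "smul 0 v = 0"
  by (rule poly_mapping_eqI) simp

lemma smul_zero_right [simp]: "smul c 0 = 0"
  by (rule poly_mapping_eqI) simp

lemma smul_one [simp]: "smul 1 v = v"
  by (rule poly_mapping_eqI) simp

lemma smul_smul [simp]: "smul c (smul d v) = smul (c * d) v"
  by (rule poly_mapping_eqI) simp

lemma smul_single [simp]: "smul c (Poly_Mapping.single i d) = Poly_Mapping.single i (c * d)"
  by (rule poly_mapping_eqI) (simp add: lookup_single when_def)

lemma smul_sum: "smul c (sum f S) = (\<Sum>i\<in>S. smul c (f i))"
  by (rule poly_mapping_eqI) (simp add: lookup_sum sum_distrib_left)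

text \<open>Reduces additive identities to single terms: updating \<open>v\<close> at an index
  outside its support adds one term. The zero vector is covered as a single term with coefficient
  0.\<close>

lemma poly_mapping_single_add_induct [case_names single add]:
  fixes v :: "'i \<Rightarrow>\<^sub>0 'a::comm_monoid_add"
  assumes single: "\<And>i c. P (Poly_Mapping.single i c)"
    and add: "\<And>u v. P u \<Longrightarrow> P v \<Longrightarrow> P (u + v)"
  shows "P v"
proof (induction v rule: update_induct)
  case const
  show ?case using single[of undefined 0] by simp
next
  case (update v i c)
  have "Poly_Mapping.update i c v = Poly_Mapping.single i c + v"
    by (rule poly_mapping_eqI)
      (use update.hyps(1) in \<open>auto simp: lookup_update lookup_add lookup_single when_def in_keys_iff\<close>)
  then show ?case using single add update.IH by simp
qed

section \<open>Linear extension from a basis\<close>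

definition lin_ext :: "('i \<Rightarrow> ('j \<Rightarrow>\<^sub>0 'k::field)) \<Rightarrow> ('i \<Rightarrow>\<^sub>0 'k) \<Rightarrow> ('j \<Rightarrow>\<^sub>0 'k)"
  where "lin_ext f v = (\<Sum>i\<in>Poly_Mapping.keys v. smul (Poly_Mapping.lookup v i) (f i))"

text \<open>Cancellation can shrink the support of a sum; this allows \<open>u\<close>,
  \<open>v\<close> and \<open>u + v\<close> to be compared over one common index set.\<close>

lemma lin_ext_superset:
  assumes "finite S" "Poly_Mapping.keys v \<subseteq> S"
  shows "lin_ext f v = (\<Sum>i\<in>S. smul (Poly_Mapping.lookup v i) (f i))"
  unfolding lin_ext_def
  by (rule sum.mono_neutral_left) (use assms in \<open>auto simp: in_keys_iff\<close>)

lemma lin_ext_add: "lin_ext f (u + v) = lin_ext f u + lin_ext f v"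
proof -
  let ?S = "Poly_Mapping.keys u \<union> Poly_Mapping.keys v"
  have "lin_ext f w = (\<Sum>i\<in>?S. smul (Poly_Mapping.lookup w i) (f i))"
    if "w \<in> {u, v, u + v}" for w
    by (rule lin_ext_superset) (use that Poly_Mapping.keys_add[of u v] in auto)
  then show ?thesis
    by (simp add: lookup_add smul_add_left sum.distrib)
qed

lemma lin_ext_single [simp]: "lin_ext f (Poly_Mapping.single i c) = smul c (f i)"
  by (subst lin_ext_superset[of "{i}"]) simp_all

lemma lin_ext_zero [simp]: "lin_ext f 0 = 0"
  by (simp add: lin_ext_def)

lemma lin_ext_fun_add: "lin_ext (\<lambda>i. f i + g i) v = lin_ext f v + lin_ext g v"
  by (simp add: lin_ext_def smul_add_right sum.distrib)

lemma lin_ext_fun_smul: "lin_ext (\<lambda>i. smul c (f i)) v = smul c (lin_ext f v)"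
  by (simp add: lin_ext_def smul_sum mult.commute)

section \<open>The action of words given by a transition function\<close>

text \<open>A partial automaton: \<open>None\<close> will stand for the zero vector, so each letter
  sends a basis vector to a basis vector or to zero.\<close>

primrec run :: "('i \<Rightarrow> 'x \<Rightarrow> 'i option) \<Rightarrow> 'i \<Rightarrow> 'x list \<Rightarrow> 'i option" where
  "run tr i [] = Some i"
| "run tr i (x # xs) = Option.bind (tr i x) (\<lambda>j. run tr j xs)"

lemma run_append: "run tr i (xs @ ys) = Option.bind (run tr i xs) (\<lambda>j. run tr j ys)"
  by (induction xs arbitrary: i) (auto split: bind_split)

definition basis_or_zero :: "'i option \<Rightarrow> ('i \<Rightarrow>\<^sub>0 'k::field)"
  where "basis_or_zero z = (case z of None \<Rightarrow> 0 | Some j \<Rightarrow> Poly_Mapping.single j 1)"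

definition run_act ::
    "('i \<Rightarrow> 'x \<Rightarrow> 'i option) \<Rightarrow> ('i \<Rightarrow>\<^sub>0 'k::field) \<Rightarrow> ('x, 'k) free_algebra \<Rightarrow> ('i \<Rightarrow>\<^sub>0 'k)"
  where "run_act tr v p =
    lin_ext (\<lambda>i. lin_ext (\<lambda>u. basis_or_zero (run tr i (letters u))) p) v"

lemma run_act_add_left: "run_act tr (u + v) p = run_act tr u p + run_act tr v p"
  by (simp add: run_act_def lin_ext_add)

lemma run_act_add_right: "run_act tr v (p + q) = run_act tr v p + run_act tr v q"
  by (simp add: run_act_def lin_ext_add lin_ext_fun_add)

lemma run_act_zero_left: "run_act tr 0 p = 0"
  by (simp add: run_act_def)

lemma run_act_single_single:
  "run_act tr (Poly_Mapping.single i c) (Poly_Mapping.single u d) =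
    smul (c * d) (basis_or_zero (run tr i (letters u)))"
  by (simp add: run_act_def)

lemma run_act_single:
  "run_act tr v (Poly_Mapping.single u d) =
    smul d (lin_ext (\<lambda>i. basis_or_zero (run tr i (letters u))) v)"
  by (simp add: run_act_def lin_ext_fun_smul)

lemma lin_ext_basis: "lin_ext (\<lambda>i. Poly_Mapping.single i 1) v = v"
  by (induction v rule: poly_mapping_single_add_induct) (simp_all add: lin_ext_add)

lemma run_act_scalar: "run_act tr v (scalar c) = smul c v"
  by (simp add: scalar_def run_act_single zero_free_monoid_def basis_or_zero_def lin_ext_basis)

text \<open>Associativity is the point: both sides are additive in \<open>v\<close>,
  \<open>p\<close> and \<open>q\<close>, so it suffices to compare single terms, where it is
  \<open>run_append\<close>.\<close>

lemma right_module_run_act: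
  fixes tr :: "'i \<Rightarrow> 'x \<Rightarrow> 'i option"
  shows "right_module (run_act tr :: _ \<Rightarrow> ('x, 'k::field) free_algebra \<Rightarrow> _)"
proof
  fix v and p q :: "('x, 'k) free_algebra"
  have singles: "run_act tr (Poly_Mapping.single i c) (Poly_Mapping.single u d * Poly_Mapping.single u' e)
    = run_act tr (run_act tr (Poly_Mapping.single i c) (Poly_Mapping.single u d)) (Poly_Mapping.single u' e)"
    for i u u' and c d e :: 'k
    by (cases "run tr i (letters u)")
      (simp_all add: mult_single run_act_single plus_free_monoid_def run_append basis_or_zero_def mult_ac)
  show "run_act tr v (p * q) = run_act tr (run_act tr v p) q"
  proof (induction v rule: poly_mapping_single_add_induct)
    case (single i c)
    show ?case
    proof (induction p rule: poly_mapping_single_add_induct)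
      case (single u d)
      show ?case
        by (induction q rule: poly_mapping_single_add_induct)
          (simp_all add: singles run_act_add_right distrib_left)
    qed (simp add: run_act_add_left run_act_add_right distrib_right)
  qed (simp add: run_act_add_left)
  show "run_act tr v 1 = v"
    using run_act_scalar[of tr v 1] by (simp add: scalar_one)
qed (simp_all add: run_act_add_left run_act_add_right)

text \<open>Scalars are multiples of the empty word, which fixes every state; so the dimension in
  \<open>growth\<close> is that of the usual coefficientwise structure.\<close>

lemma rscale_run_act: "rscale (run_act tr) = smul"
  by (simp add: fun_eq_iff rscale_def run_act_scalar)

section \<open>Growth of modules over the free algebra\<close>

text \<open>\<open>scalar c\<close> multiplies from the right in both modules, so homogeneity is
  \<open>act_mult\<close>. This lets spans pass through \<open>act v\<close>.\<close>

lemma module_hom_act: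
  fixes act :: "'v::ab_group_add \<Rightarrow> ('x, 'k::field) free_algebra \<Rightarrow> 'v"
  assumes "right_module act"
  shows "module_hom (rscale (*)) (rscale act) (act v)"
proof -
  interpret right_module act by fact
  interpret V: vector_space "rscale act" by (rule vector_space_rscale[OF assms])
  interpret F: vector_space "rscale ((*) :: ('x, 'k) free_algebra \<Rightarrow> _)"
    by (rule vector_space_rscale[OF right_module_regular])
  show ?thesis
    by standard (simp_all add: act_add_right rscale_def act_mult)
qed

lemma finite_words_le: "finite {w :: 'x::finite free_monoid. monomial_deg w \<le> n}"
  and card_words_le: "card {w :: 'x free_monoid. monomial_deg w \<le> n} = (\<Sum>i\<le>n. CARD('x) ^ i)"
proof -
  have eq: "{w :: 'x free_monoid. monomial_deg w \<le> n} = Word ` {xs. set xs \<subseteq> UNIV \<and> length xs \<le> n}"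
    unfolding monomial_deg_def by (auto simp: image_iff) (metis free_monoid.collapse)
  show "finite {w :: 'x free_monoid. monomial_deg w \<le> n}"
    unfolding eq by (intro finite_imageI finite_lists_length_le) simp
  show "card {w :: 'x free_monoid. monomial_deg w \<le> n} = (\<Sum>i\<le>n. CARD('x) ^ i)"
    unfolding eq
    by (subst card_image) (use card_lists_length_le[of "UNIV :: 'x set" n] in \<open>auto simp: inj_on_def\<close>)
qed

text \<open>By linearity of \<open>act v\<close>, monomials can replace all of R(n). For finite
  \<open>A\<close> over a finite alphabet the spanning family becomes finite.\<close>

lemma growth_space_eq_span_monomials:
  fixes act :: "'v::ab_group_add \<Rightarrow> ('x, 'k::field) free_algebra \<Rightarrow> 'v"
  assumes "right_module act"
  shows "growth_space act A n = module.span (rscale act)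
    ((\<lambda>(v, w). act v (monomial w)) ` (A \<times> {w. monomial_deg w \<le> n}))"
proof -
  interpret V: vector_space "rscale act" by (rule vector_space_rscale[OF assms])
  interpret F: vector_space "rscale ((*) :: ('x, 'k) free_algebra \<Rightarrow> _)"
    by (rule vector_space_rscale[OF right_module_regular])
  let ?T = "(\<lambda>(v, w). act v (monomial w)) ` (A \<times> {w. monomial_deg w \<le> n})"
  have "act v p \<in> V.span ?T" if "v \<in> A" "p \<in> deg_le n" for v p
  proof -
    interpret h: module_hom "rscale (*)" "rscale act" "act v" by (rule module_hom_act[OF assms])
    have "act v p \<in> V.span (act v ` {monomial w |w. monomial_deg w \<le> n})"
      using that unfolding deg_le_def h.span_image by blast
    also have "\<dots> \<subseteq> V.span ?T"
      using that by (intro V.span_mono) auto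
    finally show ?thesis .
  qed
  moreover have "act v (monomial w) \<in> V.span {act a p |a p. a \<in> A \<and> p \<in> deg_le n}"
    if "v \<in> A" "monomial_deg w \<le> n" for v w
  proof (rule V.span_base)
    have "monomial w \<in> (deg_le n :: ('x, 'k) free_algebra set)"
      unfolding deg_le_def using that by (intro F.span_base) auto
    then show "act v (monomial w) \<in> {act a p |a p. a \<in> A \<and> p \<in> deg_le n}"
      using that by auto
  qed
  ultimately show ?thesis
    unfolding growth_space_def V.span_eq by auto
qed

lemma growth_le_card:
  fixes act :: "'v::ab_group_add \<Rightarrow> ('x::finite, 'k::field) free_algebra \<Rightarrow> 'v"
  assumes "right_module act" "finite A"
  shows "growth act A n \<le> card A * (\<Sum>i\<le>n. CARD('x) ^ i)"
proof -
  interpret V: vector_space "rscale act" by (rule vector_space_rscale[OF assms(1)])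
  let ?I = "A \<times> {w :: 'x free_monoid. monomial_deg w \<le> n}"
  have fin: "finite ?I" using assms(2) finite_words_le by blast
  have "growth act A n \<le> card ((\<lambda>(v, w). act v (monomial w)) ` ?I)"
    unfolding growth_def growth_space_eq_span_monomials[OF assms(1)]
    using fin by (intro V.dim_le_card) auto
  also have "\<dots> \<le> card ?I" by (rule card_image_le[OF fin])
  finally show ?thesis by (simp add: card_cartesian_product card_words_le)
qed

lemma card_le_growth:
  fixes act :: "'v::ab_group_add \<Rightarrow> ('x::finite, 'k::field) free_algebra \<Rightarrow> 'v"
  assumes "right_module act" "finite A"
    and "\<not> module.dependent (rscale act) B" "B \<subseteq> growth_space act A n"
  shows "card B \<le> growth act A n"
proof -
  interpret V: vector_space "rscale act" by (rule vector_space_rscale[OF assms(1)])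
  let ?I = "A \<times> {w :: 'x free_monoid. monomial_deg w \<le> n}"
  let ?T = "(\<lambda>(v, w). act v (monomial w)) ` ?I"
  have fin: "finite ?T" using assms(2) finite_words_le by blast
  obtain C where C: "C \<subseteq> growth_space act A n" "V.independent C"
      "growth_space act A n \<subseteq> V.span C" "card C = growth act A n"
    using V.basis_exists[of "growth_space act A n"] unfolding growth_def by metis
  \<comment> \<open>An infinite \<open>C\<close> would have \<open>card\<close> 0 and bound
    nothing.\<close>
  have "finite C"
    using V.independent_span_bound[OF fin C(2)] C(1)
    unfolding growth_space_eq_span_monomials[OF assms(1)] by blast
  then show ?thesis
    using V.independent_span_bound[of C B] assms(3,4) C(3,4) by auto
qed

text \<open>The constant factor \<open>card A\<close> is at most \<open>?r ^ card A\<close>, and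
  multiplying the geometric sum by that power only shifts its exponents. So a shift of the argument
  absorbs the factor.\<close>

lemma growth_le_regular:
  fixes act :: "'v::ab_group_add \<Rightarrow> ('x::finite, 'k::field) free_algebra \<Rightarrow> 'v"
  assumes "right_module act" "finite A" "CARD('x) > 1"
  shows "growth act A n \<le> growth ((*) :: ('x, 'k) free_algebra \<Rightarrow> _) {1} (n + card A)"
proof -
  let ?r = "CARD('x)"
  have "card A \<le> ?r ^ card A" using assms(3) by (simp add: order_less_imp_le self_le_power less_exp)
  then have "growth act A n \<le> ?r ^ card A * (\<Sum>i\<le>n. ?r ^ i)"
    using growth_le_card[OF assms(1,2), of n] by (meson le_trans mult_le_mono1)
  also have "\<dots> = (\<Sum>i\<in>(\<lambda>i. i + card A) ` {..n}. ?r ^ i)"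
    by (subst sum.reindex) (simp_all add: sum_distrib_left power_add mult.commute)
  also have "\<dots> \<le> (\<Sum>i\<le>n + card A. ?r ^ i)"
    by (rule sum_mono2) auto
  finally show ?thesis by (simp add: growth_regular)
qed


section \<open>A tree of words with sparse returning branches\<close>

locale distinct_letters =
  fixes a b :: "'x::finite"
  assumes a_neq_b: "a \<noteq> b"
begin

lemma two_le_card: "2 \<le> CARD('x)"
  using card_mono[of UNIV "{a, b}"] a_neq_b by simp

section \<open>Paddings and forbidden prefixes\<close>

text \<open>The length is paired in so that the enumeration also satisfies
  \<open>length w \<le> code w\<close>.\<close>

definition code :: "'x list \<Rightarrow> nat"
  where "code w = prod_encode (length w, to_nat w)"

text \<open>Doubling with each code makes the gaps between paddings exceed the lengths of the words,
  and makes the killers so rare that all of them together cost at most half of the words.\<close>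

definition pad :: "'x list \<Rightarrow> nat"
  where "pad w = 2 ^ (code w + 2)"

definition killer :: "'x list \<Rightarrow> 'x list"
  where "killer w = replicate (pad w) a @ [b]"

definition good :: "'x list \<Rightarrow> bool"
  where "good v \<longleftrightarrow> (\<nexists>w w0. length w \<le> length w0 \<and> prefix (w @ killer w0) v)"

lemma code_inject: "code w = code w' \<longleftrightarrow> w = w'"
  by (auto simp: code_def)

lemma length_le_code: "length w \<le> code w"
  by (simp add: code_def le_prod_encode_1)

text \<open>\<open>pad w'\<close> is at least twice \<open>pad w\<close>, and
  \<open>length w\<close> is below \<open>pad w\<close>.\<close>

lemma pad_gap:
  assumes "code w < code w'"
  shows "pad w + length w < pad w'"
proof -
  have "length w < 2 ^ (code w + 2)"
    using length_le_code[of w] less_exp[of "code w + 2"] by linarith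
  then have "pad w + length w < 2 ^ (code w + 3)"
    by (simp add: pad_def power_add)
  also have "\<dots> \<le> pad w'"
    unfolding pad_def using assms by (intro power_increasing) auto
  finally show ?thesis .
qed

text \<open>The gaps between the paddings make the lengths alone determine the decomposition.\<close>

lemma append_killer_eq_iff:
  assumes "length w \<le> length w0"
  shows "w @ killer w0 = w1 @ killer w1 \<longleftrightarrow> w = w0 \<and> w1 = w0"
proof
  assume eq: "w @ killer w0 = w1 @ killer w1"
  then have len: "length w + pad w0 = length w1 + pad w1"
    by (auto simp: killer_def dest: arg_cong[where f = length])
  \<comment> \<open>If \<open>code w0\<close> were smaller, \<open>length w \<le> length w0\<close>
    would put the left side of \<open>len\<close> below \<open>pad w1\<close>; if it were larger,
    the right side would lie below \<open>pad w0\<close>.\<close>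
  have "code w0 = code w1"
    using pad_gap[of w0 w1] pad_gap[of w1 w0] len assms by (cases "code w0" "code w1" rule: linorder_cases) auto
  with eq show "w = w0 \<and> w1 = w0"
    by (simp add: code_inject)
qed auto

lemma good_Nil: "good []"
  by (simp add: good_def killer_def)

lemma good_appendD: "good (v @ u) \<Longrightarrow> good v"
  unfolding good_def by (meson prefix_prefix)

text \<open>A forbidden prefix ends in \<open>b\<close>, so appending \<open>a\<close> never
  completes one. Hence a killer can leave the basis only at its last letter.\<close>

lemma good_append_replicate: "good v \<Longrightarrow> good (v @ replicate j a)"
proof (induction j)
  case (Suc j)
  have "w @ killer w0 \<noteq> v @ replicate (Suc j) a" for w w0
    using a_neq_b by (auto simp: killer_def simp flip: replicate_append_same append_assoc)
  with Suc show ?case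
    unfolding good_def by (auto simp flip: replicate_append_same append_assoc)
qed simp

lemma not_good_append_killer: "length w \<le> length w0 \<Longrightarrow> \<not> good (w @ killer w0)"
  by (auto simp: good_def)

section \<open>Numbering the good words\<close>

lemma countable_good: "countable {v. good v}"
  by simp

text \<open>Makes the enumeration a bijection with all of \<open>nat\<close>, so that every number
  is the index of a good word.\<close>

lemma infinite_good: "infinite {v. good v}"
proof -
  have "range (\<lambda>j. replicate j a) \<subseteq> {v. good v}"
    using good_append_replicate[OF good_Nil] by auto
  moreover have "infinite (range (\<lambda>j. replicate j a))"
    by (intro range_inj_infinite) (auto simp: inj_def dest: arg_cong[where f = length])
  ultimately show ?thesis using infinite_super by blast
qed

text \<open>The module is to live on \<open>nat \<Rightarrow>\<^sub>0 'k\<close>, so basis words are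
  replaced by their numbers.\<close>

definition idx :: "'x list \<Rightarrow> nat"
  where "idx = to_nat_on {v. good v}"

definition word :: "nat \<Rightarrow> 'x list"
  where "word = from_nat_into {v. good v}"

lemma good_word: "good (word n)"
  using from_nat_into[of "{v. good v}" n] good_Nil by (auto simp: word_def)

lemma idx_word [simp]: "idx (word n) = n"
  by (simp add: idx_def word_def to_nat_on_from_nat_into_infinite[OF countable_good infinite_good])

lemma word_idx [simp]: "good v \<Longrightarrow> word (idx v) = v"
  by (simp add: idx_def word_def from_nat_into_to_nat_on[OF countable_good])

section \<open>The transition function and its runs\<close>

definition tr :: "nat \<Rightarrow> 'x \<Rightarrow> nat option"
  where "tr n x = (let v = word n @ [x] in
    if good v then Some (idx v)
    else if \<exists>w. v = w @ killer w then Some (idx []) else None)"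

text \<open>Prefixes of a good word are good, so the run stays in the basis and merely
  appends.\<close>

lemma run_good: "good (v @ u) \<Longrightarrow> run tr (idx v) u = Some (idx (v @ u))"
proof (induction u arbitrary: v)
  case (Cons x u)
  then have "good v" "good (v @ [x])"
    using good_appendD[of v] good_appendD[of "v @ [x]" u] by auto
  then show ?case
    using Cons by (simp add: tr_def)
qed simp

text \<open>Up to the last letter the run only appends; the final \<open>b\<close> then completes a
  forbidden prefix. Uniqueness of the decomposition shows that the word reached has the returning
  form only for \<open>w = w0\<close>.\<close>

lemma run_killer:
  assumes "good w" "length w \<le> length w0"
  shows "run tr (idx w) (killer w0) = (if w = w0 then Some (idx []) else None)"
proof -
  let ?v = "w @ replicate (pad w0) a"
  have good: "good ?v" by (rule good_append_replicate[OF assms(1)])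
  have v: "?v @ [b] = w @ killer w0" by (simp add: killer_def)
  have "run tr (idx w) (killer w0) = tr (idx ?v) b"
    unfolding killer_def run_append run_good[OF good] by (simp add: bind_split split: option.split)
  also have "\<dots> = (if w = w0 then Some (idx []) else None)"
    unfolding tr_def word_idx[OF good] v Let_def
    by (simp add: not_good_append_killer[OF assms(2)] append_killer_eq_iff[OF assms(2)])
  finally show ?thesis .
qed

section \<open>Counting the lost words\<close>

text \<open>A killer at a fixed position takes away the choice of \<open>pad w0 + 1\<close> letters.
  The product form avoids a subtraction in the exponent and covers words too short to contain the
  killer.\<close>

lemma card_contains_killer_at:
  "card {v. length v = n \<and> (\<exists>w u. v = w @ killer w0 @ u \<and> length w = j)} * CARD('x) ^ (pad w0 + 1)
    \<le> CARD('x) ^ n" (is "card ?B * _ \<le> _")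
proof (cases "j + pad w0 + 1 \<le> n")
  case True
  define m where "m = n - (j + pad w0 + 1)"
  have n: "n = j + m + (pad w0 + 1)" using True by (simp add: m_def)
  let ?L = "\<lambda>i. {w :: 'x list. length w = i}"
  have L: "finite (?L i)" "card (?L i) = CARD('x) ^ i" for i
    using finite_lists_length_eq[of "UNIV :: 'x set" i] card_lists_length_eq[of "UNIV :: 'x set" i] by auto
  have "?B \<subseteq> (\<lambda>(w, u). w @ killer w0 @ u) ` (?L j \<times> ?L m)"
    by (auto simp: n killer_def image_iff)
  then have "card ?B \<le> card (?L j \<times> ?L m)"
    using L(1) by (meson card_image_le card_mono finite_SigmaI finite_imageI le_trans)
  then have "card ?B \<le> CARD('x) ^ (j + m)"
    by (simp add: card_cartesian_product L(2) power_add)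
  then show ?thesis
    unfolding n power_add[of _ "j + m"] by (rule mult_le_mono1)
next
  case False
  then have "?B = {}" by (auto simp: killer_def)
  then show ?thesis by (simp only: card.empty mult_0 le0)
qed

text \<open>Union bound over the \<open>Suc (length w0)\<close> positions, of which there are at
  most \<open>2 ^ code w0\<close>.\<close>

lemma card_contains_killer:
  "real (card {v. length v = n \<and> (\<exists>w. length w \<le> length w0 \<and> prefix (w @ killer w0) v)})
    \<le> real (CARD('x) ^ n) / 2 ^ (code w0 + 2)" (is "real (card ?B) \<le> _")
proof -
  let ?r = "CARD('x)" and ?c = "code w0"
  let ?C = "\<lambda>j. {v. length v = n \<and> (\<exists>w u. v = w @ killer w0 @ u \<and> length w = j)}"
  have fin: "finite {v :: 'x list. length v = n}"
    using finite_lists_length_eq[of "UNIV :: 'x set" n] by simp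
  have "?B \<subseteq> (\<Union>j\<le>length w0. ?C j)"
    by (auto simp: prefix_def)
  then have "card ?B \<le> card (\<Union>j\<le>length w0. ?C j)"
    by (intro card_mono finite_UN_I) (auto intro: finite_subset[OF _ fin])
  also have "\<dots> \<le> (\<Sum>j\<le>length w0. card (?C j))"
    by (rule card_UN_le) simp
  finally have "card ?B * ?r ^ (pad w0 + 1) \<le> (\<Sum>j\<le>length w0. card (?C j)) * ?r ^ (pad w0 + 1)"
    by (rule mult_le_mono1)
  also have "\<dots> \<le> (\<Sum>j\<le>length w0. ?r ^ n)"
    unfolding sum_distrib_right by (rule sum_mono) (rule card_contains_killer_at)
  also have "\<dots> = Suc (length w0) * ?r ^ n"
    by simp
  also have "\<dots> \<le> 2 ^ ?c * ?r ^ n"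
    using length_le_code[of w0] less_exp[of ?c] by (intro mult_le_mono1) linarith
  finally have *: "card ?B * ?r ^ (pad w0 + 1) \<le> 2 ^ ?c * ?r ^ n" .
  \<comment> \<open>The exponent is \<open>?c\<close> to cancel the number of positions, plus the
    \<open>?c + 2\<close> of the claim.\<close>
  have "2 * ?c + 2 \<le> pad w0 + 1"
    using less_exp[of ?c] unfolding pad_def power_add by (simp; linarith)
  then have "(2::nat) ^ (2 * ?c + 2) \<le> ?r ^ (pad w0 + 1)"
    using two_le_card by (meson le_trans power_increasing power_mono one_le_numeral zero_le)
  then have *: "card ?B * 2 ^ (2 * ?c + 2) \<le> 2 ^ ?c * ?r ^ n"
    using * by (meson le_trans mult_le_mono2)
  have pow: "(2::nat) ^ (2 * ?c + 2) = 2 ^ ?c * 2 ^ (?c + 2)"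
    by (simp flip: power_add)
  have "2 ^ ?c * (card ?B * 2 ^ (?c + 2)) \<le> 2 ^ ?c * ?r ^ n"
    using * unfolding pow by (simp only: mult.left_commute)
  then have "card ?B * 2 ^ (?c + 2) \<le> ?r ^ n"
    by (rule mult_left_le_imp_le) simp
  then have "real (card ?B * 2 ^ (?c + 2)) \<le> real (?r ^ n)"
    by (rule of_nat_mono)
  then show ?thesis
    by (simp add: field_simps)
qed

text \<open>Codes are distinct, so the shares \<open>1 / 2 ^ (code w0 + 2)\<close> of all killers
  are dominated by a geometric series with sum 1/2.\<close>

lemma card_not_good: "2 * card {v. length v = n \<and> \<not> good v} \<le> CARD('x) ^ n"
proof -
  let ?r = "CARD('x)"
  let ?W = "{w0 :: 'x list. code w0 < n}"
  let ?B = "\<lambda>w0. {v. length v = n \<and> (\<exists>w. length w \<le> length w0 \<and> prefix (w @ killer w0) v)}"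
  have finL: "finite {v :: 'x list. length v = n}"
    using finite_lists_length_eq[of "UNIV :: 'x set" n] by simp
  have inj: "inj_on code ?W"
    by (simp add: inj_on_def code_inject)
  have finW: "finite ?W"
    by (rule inj_on_finite[OF inj, of "{..<n}"]) auto
  \<comment> \<open>A killer has to fit into a word of length \<open>n\<close>, so only finitely
    many \<open>w0\<close> matter.\<close>
  have "code w0 < n" if "prefix (w @ killer w0) v" "length v = n" for w w0 v
  proof -
    have "pad w0 < n"
      using prefix_length_le[OF that(1)] that(2) by (simp add: killer_def)
    moreover have "code w0 < pad w0"
      using less_exp[of "code w0 + 2"] by (simp add: pad_def)
    ultimately show ?thesis by simp
  qed
  then have "{v. length v = n \<and> \<not> good v} \<subseteq> (\<Union>w0\<in>?W. ?B w0)"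
    unfolding good_def by fastforce
  then have "card {v. length v = n \<and> \<not> good v} \<le> card (\<Union>w0\<in>?W. ?B w0)"
    by (intro card_mono finite_UN_I finW) (auto intro: finite_subset[OF _ finL])
  also have "\<dots> \<le> (\<Sum>w0\<in>?W. card (?B w0))"
    by (rule card_UN_le[OF finW])
  finally have "real (card {v. length v = n \<and> \<not> good v}) \<le> (\<Sum>w0\<in>?W. real (card (?B w0)))"
    unfolding of_nat_sum[symmetric] by (rule of_nat_mono)
  also have "\<dots> \<le> (\<Sum>w0\<in>?W. real (?r ^ n) / 2 ^ (code w0 + 2))"
    by (rule sum_mono) (rule card_contains_killer)
  also have "\<dots> = (\<Sum>k\<in>code ` ?W. real (?r ^ n) / 2 ^ (k + 2))"
    by (subst sum.reindex[OF inj]) simp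
  also have "\<dots> \<le> (\<Sum>k<n. real (?r ^ n) / 2 ^ (k + 2))"
    by (rule sum_mono2) auto
  also have "\<dots> = real (?r ^ n) / 2 * (1 - 1 / 2 ^ n)"
  proof -
    have "(\<Sum>k<m. x / 2 ^ (k + 2)) = x / 2 * (1 - 1 / 2 ^ m)" for x :: real and m
      by (induction m) (simp_all add: field_simps)
    then show ?thesis .
  qed
  also have "\<dots> \<le> real (?r ^ n) / 2"
    by (simp add: field_simps)
  finally have "real (2 * card {v. length v = n \<and> \<not> good v}) \<le> real (?r ^ n)"
    by simp
  then show ?thesis
    by (simp only: of_nat_le_iff)
qed

text \<open>One extra letter multiplies the number of words by at least 2, which makes up for the
  lost half.\<close>

lemma card_good_Suc: "CARD('x) ^ n \<le> card {v. length v = Suc n \<and> good v}"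
proof -
  let ?r = "CARD('x)"
  have fin: "finite {v :: 'x list. length v = Suc n}"
    using finite_lists_length_eq[of "UNIV :: 'x set" "Suc n"] by simp
  have "?r ^ Suc n = card {v :: 'x list. length v = Suc n}"
    using card_lists_length_eq[of "UNIV :: 'x set" "Suc n"] by simp
  also have "{v :: 'x list. length v = Suc n} =
      {v. length v = Suc n \<and> good v} \<union> {v. length v = Suc n \<and> \<not> good v}"
    by auto
  also have "card \<dots> = card {v. length v = Suc n \<and> good v} + card {v. length v = Suc n \<and> \<not> good v}"
    by (rule card_Un_disjoint) (auto intro: finite_subset[OF _ fin])
  finally have "?r ^ Suc n \<le> 2 * card {v. length v = Suc n \<and> good v}"
    using card_not_good[of "Suc n"] by linarith
  moreover have "2 * ?r ^ n \<le> ?r ^ Suc n" using two_le_card by simp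
  ultimately show ?thesis by linarith
qed

lemma finite_good_le: "finite {v. length v \<le> n \<and> good v}"
  by (rule finite_subset[OF _ finite_lists_length_le[of "UNIV :: 'x set" n]]) auto

lemma card_good_le: "(\<Sum>i\<le>n. CARD('x) ^ i) \<le> card {v. length v \<le> Suc n \<and> good v}"
proof -
  have "(\<Sum>i\<le>n. CARD('x) ^ i) \<le> (\<Sum>i\<le>n. card {v. length v = Suc i \<and> good v})"
    by (rule sum_mono) (rule card_good_Suc)
  also have "\<dots> = card (\<Union>i\<le>n. {v. length v = Suc i \<and> good v})"
    by (rule card_UN_disjoint[symmetric]) (auto intro: finite_subset[OF _ finite_good_le])
  also have "\<dots> \<le> card {v. length v \<le> Suc n \<and> good v}"
    by (intro card_mono finite_good_le) auto
  finally show ?thesis .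
qed

section \<open>The simple module\<close>

lemma run_act_to_root:
  fixes v :: "nat \<Rightarrow>\<^sub>0 'k::field"
  assumes "v \<noteq> 0"
  obtains u d where "run_act tr v (Poly_Mapping.single (Word u) d) = Poly_Mapping.single (idx []) 1"
proof -
  let ?K = "Poly_Mapping.keys v"
  have "?K \<noteq> {}" using assms by simp
  then have "Max ((\<lambda>j. length (word j)) ` ?K) \<in> (\<lambda>j. length (word j)) ` ?K"
    by (intro Max_in) auto
  then obtain i where i_max: "Max ((\<lambda>j. length (word j)) ` ?K) = length (word i)" and i: "i \<in> ?K"
    by (rule imageE)
  have max: "length (word j) \<le> length (word i)" if "j \<in> ?K" for j
    unfolding i_max[symmetric] using that by (intro Max_ge) auto
  \<comment> \<open>By injectivity of \<open>word\<close>, other support words are killed even if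
    they have the same maximal length.\<close>
  have "word j = word i \<longleftrightarrow> j = i" for j
    by (metis idx_word)
  then have run: "run tr j (killer (word i)) = (if j = i then Some (idx []) else None)" if "j \<in> ?K" for j
    using run_killer[OF good_word max[OF that]] by simp
  have "lin_ext (\<lambda>j. basis_or_zero (run tr j (killer (word i)))) v =
      (\<Sum>j\<in>?K. if j = i then Poly_Mapping.single (idx []) (Poly_Mapping.lookup v i) else 0)"
    unfolding lin_ext_def by (rule sum.cong) (auto simp: run basis_or_zero_def)
  also have "\<dots> = Poly_Mapping.single (idx []) (Poly_Mapping.lookup v i)"
    using i by simp
  \<comment> \<open>The coefficient of the monomial normalises the one surviving coefficient to
    1.\<close>
  finally have "run_act tr v (Poly_Mapping.single (Word (killer (word i))) (1 / Poly_Mapping.lookup v i))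
      = Poly_Mapping.single (idx []) 1"
    using i by (simp add: run_act_single in_keys_iff)
  then show thesis by (rule that)
qed

lemma run_act_root:
  assumes "good v"
  shows "run_act tr (Poly_Mapping.single (idx []) 1) (Poly_Mapping.single (Word v) c) =
    Poly_Mapping.single (idx v) c"
  using run_good[of "[]" v] assms by (simp add: run_act_single_single basis_or_zero_def)

text \<open>A nonzero vector leads to the root, the root leads to every single term, and these
  generate additively.\<close>

lemma submodule_run_act_trivial:
  fixes U :: "(nat \<Rightarrow>\<^sub>0 'k::field) set"
  assumes "submodule (run_act tr) U" "U \<noteq> {0}"
  shows "U = UNIV"
proof -
  have closed: "u + v \<in> U" "run_act tr u p \<in> U" if "u \<in> U" "v \<in> U" for u v p
    using assms(1) that by (auto simp: submodule_def)
  obtain v where v: "v \<in> U" "v \<noteq> 0"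
    using assms by (auto simp: submodule_def)
  have root: "Poly_Mapping.single (idx []) 1 \<in> U"
    using run_act_to_root[OF v(2)] closed(2)[OF v(1) v(1)] by metis
  have "w \<in> U" for w
  proof (induction w rule: poly_mapping_single_add_induct)
    case (single i c)
    then show ?case
      using closed(2)[OF root root, of "Poly_Mapping.single (Word (word i)) c"]
      by (simp add: run_act_root good_word)
  qed (rule closed)
  then show ?thesis by blast
qed

lemma simple_run_act:
  "simple_right_module (run_act tr :: (nat \<Rightarrow>\<^sub>0 'k::field) \<Rightarrow> ('x, 'k) free_algebra \<Rightarrow> _)"
  unfolding simple_right_module_def
proof (intro conjI allI impI)
  have "Poly_Mapping.single 0 (1::'k) \<noteq> (0 :: nat \<Rightarrow>\<^sub>0 'k)"
    by (metis lookup_single_eq lookup_zero zero_neq_one)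
  then show "(UNIV :: (nat \<Rightarrow>\<^sub>0 'k) set) \<noteq> {0}" by blast
  show "right_module (run_act tr :: (nat \<Rightarrow>\<^sub>0 'k) \<Rightarrow> ('x, 'k) free_algebra \<Rightarrow> _)"
    by (rule right_module_run_act)
  show "U = {0} \<or> U = UNIV"
    if "submodule (run_act tr :: _ \<Rightarrow> ('x, 'k) free_algebra \<Rightarrow> _) U" for U :: "(nat \<Rightarrow>\<^sub>0 'k) set"
    using submodule_run_act_trivial[OF that] by blast
qed

section \<open>Growth of the simple module\<close>

text \<open>Some monomial takes \<open>v\<close> to the root up to a scalar; from there the good
  words of length at most \<open>Suc n\<close> give distinct basis vectors, and
  \<open>card_good_le\<close> counts them.\<close>

lemma regular_le_growth:
  fixes A :: "(nat \<Rightarrow>\<^sub>0 'k::field) set"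
  assumes "finite A" "v \<in> A" "v \<noteq> 0"
  shows "\<exists>C. \<forall>n. growth ((*) :: ('x, 'k) free_algebra \<Rightarrow> _) {1} n \<le> growth (run_act tr) A (n + C)"
proof -
  let ?act = "run_act tr :: (nat \<Rightarrow>\<^sub>0 'k) \<Rightarrow> ('x, 'k) free_algebra \<Rightarrow> _"
  interpret right_module ?act by (rule right_module_run_act)
  interpret V: vector_space "smul :: 'k \<Rightarrow> (nat \<Rightarrow>\<^sub>0 'k) \<Rightarrow> _"
    using vector_space_rscale[OF right_module_run_act, of tr] by (simp only: rscale_run_act)
  interpret F: vector_space "rscale ((*) :: ('x, 'k) free_algebra \<Rightarrow> _)"
    by (rule vector_space_rscale[OF right_module_regular])
  obtain u and d :: 'k where
      ud: "?act v (Poly_Mapping.single (Word u) d) = Poly_Mapping.single (idx []) 1"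
    using run_act_to_root[OF assms(3)] .
  \<comment> \<open>The shift pays \<open>length u\<close> letters for reaching the root and one for
    the lost half of the words.\<close>
  have "growth ((*) :: ('x, 'k) free_algebra \<Rightarrow> _) {1} n \<le> growth ?act A (n + Suc (length u))" for n
  proof -
    let ?G = "{w. length w \<le> Suc n \<and> good w}"
    let ?e = "\<lambda>w. Poly_Mapping.single (idx w) (1 :: 'k)"
    have inj: "inj_on ?e ?G"
    proof (rule inj_onI)
      fix w w' assume "w \<in> ?G" "w' \<in> ?G" "?e w = ?e w'"
      then have "idx w = idx w'" by (metis keys_single singleton_inject zero_neq_one)
      then show "w = w'" using \<open>w \<in> ?G\<close> \<open>w' \<in> ?G\<close> by (metis (no_types, lifting) mem_Collect_eq word_idx)
    qed
    have "?e w \<in> growth_space ?act A (n + Suc (length u))" if "w \<in> ?G" for w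
    proof -
      \<comment> \<open>By \<open>act_mult\<close> the product first takes \<open>v\<close> to the
        root and then reads \<open>w\<close> from there.\<close>
      have "?e w = ?act v (Poly_Mapping.single (Word u) d * Poly_Mapping.single (Word w) 1)"
        using that by (simp only: act_mult ud) (simp add: run_act_root)
      also have "Poly_Mapping.single (Word u) d * Poly_Mapping.single (Word w) 1 =
          rscale (*) d (monomial (Word (u @ w)))"
        by (simp add: rscale_def scalar_def monomial_def mult_single plus_free_monoid_def zero_free_monoid_def)
      also have "?act v \<dots> \<in> {?act a p |a p. a \<in> A \<and> p \<in> deg_le (n + Suc (length u))}"
      proof -
        have "monomial (Word (u @ w)) \<in> (deg_le (n + Suc (length u)) :: ('x, 'k) free_algebra set)"
          unfolding deg_le_def using that
          by (intro F.span_base) (auto simp: monomial_deg_def)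
        then show ?thesis
          using assms(2) unfolding deg_le_def by (blast intro: F.span_scale)
      qed
      finally show ?thesis
        unfolding growth_space_def rscale_run_act by (rule V.span_base)
    qed
    then have sub: "?e ` ?G \<subseteq> growth_space ?act A (n + Suc (length u))" by blast
    have "V.independent (?e ` ?G)"
    proof (rule V.independent_if_scalars_zero)
      show "finite (?e ` ?G)" using finite_good_le by blast
      fix f x assume sum0: "(\<Sum>x\<in>?e ` ?G. smul (f x) x) = 0" and "x \<in> ?e ` ?G"
      then obtain w where w: "w \<in> ?G" "x = ?e w" by blast
      have idx: "idx w' = idx w \<longleftrightarrow> w' = w" if "w' \<in> ?G" for w'
        using that w(1) by (metis (no_types, lifting) mem_Collect_eq word_idx)
      have "0 = Poly_Mapping.lookup (\<Sum>w'\<in>?G. smul (f (?e w')) (?e w')) (idx w)"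
        using sum0 by (simp add: sum.reindex[OF inj])
      also have "\<dots> = (\<Sum>w'\<in>?G. if w' = w then f x else 0)"
        unfolding lookup_sum by (rule sum.cong) (use idx w in \<open>auto simp: lookup_single when_def\<close>)
      also have "\<dots> = f x"
        using w(1) finite_good_le by simp
      finally show "f x = 0" by simp
    qed
    then have "card (?e ` ?G) \<le> growth ?act A (n + Suc (length u))"
      using sub by (rule card_le_growth[OF right_module_run_act assms(1), unfolded rscale_run_act])
    then show ?thesis
      using card_good_le[of n] unfolding card_image[OF inj] growth_regular by linarith
  qed
  then show ?thesis by blast
qed

text \<open>The root alone generates, by simplicity. For arbitrary \<open>A\<close> the upper bound
  is the general one for right modules, and the lower bound starts from a nonzero vector of
  \<open>A\<close>.\<close>

lemma maximal_growth_run_act: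
  "maximal_growth (run_act tr :: (nat \<Rightarrow>\<^sub>0 'k::field) \<Rightarrow> ('x, 'k) free_algebra \<Rightarrow> _)"
  unfolding maximal_growth_def
proof (intro conjI allI impI)
  let ?act = "run_act tr :: (nat \<Rightarrow>\<^sub>0 'k) \<Rightarrow> ('x, 'k) free_algebra \<Rightarrow> _"
  let ?e = "Poly_Mapping.single (idx []) (1 :: 'k)"
  have e: "?e \<noteq> 0"
    by (metis lookup_single_eq lookup_zero zero_neq_one)
  have "U = UNIV" if "submodule ?act U" "?e \<in> U" for U
    using submodule_run_act_trivial[OF that(1)] that(2) e by blast
  then have "generates ?act {?e}"
    by (auto simp: generates_def hull_def)
  then show "\<exists>A. finite A \<and> generates ?act A" by blast
  fix A assume A: "finite A \<and> generates ?act A"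
  have r: "CARD('x) > 1"
    using two_le_card by simp
  \<comment> \<open>If \<open>A\<close> were contained in \<open>{0}\<close>, so would be its hull,
    which is the whole nonzero space.\<close>
  have "submodule ?act {0}"
    by (simp add: submodule_def run_act_zero_left)
  then have "\<not> A \<subseteq> {0}"
    using A e unfolding generates_def hull_def by blast
  then obtain v where v: "v \<in> A" "v \<noteq> 0" by blast
  have "\<exists>C. \<forall>n. growth ((*) :: ('x, 'k) free_algebra \<Rightarrow> _) {1} n \<le> growth ?act A (n + C)"
    by (rule regular_le_growth[OF conjunct1[OF A] v])
  moreover have "\<And>n. growth ?act A n \<le> growth ((*) :: ('x, 'k) free_algebra \<Rightarrow> _) {1} (n + card A)"
    using growth_le_regular[OF right_module_run_act _ r] A by blast
  ultimately show "growth_equiv (growth ?act A) (growth ((*) :: ('x, 'k) free_algebra \<Rightarrow> _) {1})"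
    unfolding growth_equiv_def by blast
qed

end

theorem corollary3:
  assumes "CARD('x::finite) > 1"
  shows "\<exists>act :: (nat \<Rightarrow>\<^sub>0 'k::field) \<Rightarrow> ('x, 'k) free_algebra \<Rightarrow> (nat \<Rightarrow>\<^sub>0 'k).
    simple_right_module act \<and> maximal_growth act"
proof -
  obtain a b :: 'x where "a \<noteq> b"
    using assms card_le_Suc0_iff_eq[of "UNIV :: 'x set"] by force
  then interpret distinct_letters a b by unfold_locales
  show ?thesis using simple_run_act maximal_growth_run_act by blast
qed

end
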